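(* Let $A$ be a Banach algebra and $I:A\to A$ the identity mapping. If $A^{**}$ has the $I$-$w^*w$ property and $A^{**}$ is weakly amenable, then $A$ is weakly amenable.
   Context: $A^{**}$ is a Banach algebra under the first Arens product: $\langle a'a,b\rangle=\langle a',ab\rangle$, $\langle a''a',a\rangle=\langle a'',a'a\rangle$, $\langle a''b'',a'\rangle=\langle a'',b''a'\rangle$ for $a,b\in A$, $a'\in A^*$, $a'',b''\in A^{**}$. $A^{**}$ has the $I$-$w^*w$ property if for every $a''\in A^{**}$ the map $b''\mapsto a''b''$, $A^{**}\to A^{**}$, is continuous from the weak$^*$ topology $\sigma(A^{**},A^* )$ to the weak topology $\sigma(A^{**},A^{***})$. A Banach algebra $B$ is weakly amenable if every bounded derivation $D:B\to B^*$ (bounded linear, $D(xy)=xD(y)+D(x)y$) is inner, i.e. of the form $D(a)=af-fa$ for some $f\in B^*$, where $B^*$ is the dual $B$-bimodule: $\langle fa,b\rangle=\langle f,ab\rangle$, $\langle af,b\rangle=\langle f,ba\rangle$. *)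

theory Defs
  imports "HOL-Analysis.Analysis" "HOL-Library.Function_Algebras"
begin

text \<open>
  The scalars are an arbitrary \<open>'k :: real_normed_field\<close>, i.e. the real or the complex numbers.
  Banach algebras are types of class \<open>{real_normed_algebra, banach}\<close> (not necessarily unital)
  with a compatible scalar multiplication by \<open>'k\<close>.
\<close>

locale banach_algebra_over = vector_space scl
  for scl :: "'k::real_normed_field \<Rightarrow> 'a::{real_normed_algebra,banach} \<Rightarrow> 'a" +
  assumes scl_of_real: "scl (of_real r) x = r *\<^sub>R x"
    and norm_scl: "norm (scl c x) = norm c * norm x"
    and scl_mult_left: "scl c x * y = scl c (x * y)"
    and scl_mult_right: "x * scl c y = scl c (x * y)"

text \<open>
  The space of \<open>'k\<close>-linear bounded functionals depends on the term \<open>scl\<close>, so it cannot be a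
  type (and the library's \<open>blinfun\<close> is only real-linear). Normed spaces and algebras are therefore
  records with an explicit carrier inside an ambient abelian group; addition and zero are those of
  the ambient group, which for functionals is pointwise (\<open>Function_Algebras\<close>).
\<close>

record ('k, 'v) nspace =
  carr :: "'v set"
  smul :: "'k \<Rightarrow> 'v \<Rightarrow> 'v"
  nrm :: "'v \<Rightarrow> real"

record ('k, 'v) nalgebra = "('k, 'v) nspace" +
  mul :: "'v \<Rightarrow> 'v \<Rightarrow> 'v"

definition algebra_of ::
  "('k::real_normed_field \<Rightarrow> 'a::{real_normed_algebra,banach} \<Rightarrow> 'a) \<Rightarrow> ('k, 'a) nalgebra" where
  "algebra_of scl = \<lparr>carr = UNIV, smul = scl, nrm = norm, mul = (*)\<rparr>"

definition bounded_linear_between ::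
  "('k, 'v::ab_group_add, 'e) nspace_scheme \<Rightarrow> ('k, 'w::ab_group_add, 'f) nspace_scheme
    \<Rightarrow> ('v \<Rightarrow> 'w) \<Rightarrow> bool" where
  "bounded_linear_between V W T \<longleftrightarrow>
     (\<forall>x\<in>carr V. T x \<in> carr W) \<and>
     (\<forall>x\<in>carr V. \<forall>y\<in>carr V. T (x + y) = T x + T y) \<and>
     (\<forall>c. \<forall>x\<in>carr V. T (smul V c x) = smul W c (T x)) \<and>
     (\<exists>M. \<forall>x\<in>carr V. nrm W (T x) \<le> M * nrm V x)"

definition scalars :: "('k::real_normed_field, 'k) nspace" where
  "scalars = \<lparr>carr = UNIV, smul = (*), nrm = norm\<rparr>"

text \<open>
  The dual space with the operator norm. A functional on \<open>carr V\<close> is represented by the function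
  that is \<open>0\<close> outside \<open>carr V\<close>, so that equal functionals are equal functions.
\<close>

definition dual ::
  "('k::real_normed_field, 'v::ab_group_add, 'e) nspace_scheme \<Rightarrow> ('k, 'v \<Rightarrow> 'k) nspace" where
  "dual V =
    \<lparr>carr = {f. bounded_linear_between V scalars f \<and> (\<forall>x. x \<notin> carr V \<longrightarrow> f x = 0)},
     smul = (\<lambda>c f x. c * f x),
     nrm = (\<lambda>f. SUP x\<in>{x \<in> carr V. nrm V x \<le> 1}. norm (f x))\<rparr>"

text \<open>
  The module actions of an algebra \<open>B\<close> on its dual: \<open>(f a)(b) = f (a b)\<close> and
  \<open>(a f)(b) = f (b a)\<close>.
\<close>

definition dual_right ::
  "('k, 'v, 'e) nalgebra_scheme \<Rightarrow> ('v \<Rightarrow> 'k::real_normed_field) \<Rightarrow> 'v \<Rightarrow> ('v \<Rightarrow> 'k)" where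
  "dual_right B f a = (\<lambda>b. if b \<in> carr B then f (mul B a b) else 0)"

definition dual_left ::
  "('k, 'v, 'e) nalgebra_scheme \<Rightarrow> 'v \<Rightarrow> ('v \<Rightarrow> 'k::real_normed_field) \<Rightarrow> ('v \<Rightarrow> 'k)" where
  "dual_left B a f = (\<lambda>b. if b \<in> carr B then f (mul B b a) else 0)"

definition bounded_derivation ::
  "('k::real_normed_field, 'v::ab_group_add, 'e) nalgebra_scheme
    \<Rightarrow> ('v \<Rightarrow> ('v \<Rightarrow> 'k)) \<Rightarrow> bool" where
  "bounded_derivation B D \<longleftrightarrow>
     bounded_linear_between B (dual B) D \<and>
     (\<forall>x\<in>carr B. \<forall>y\<in>carr B. D (mul B x y) = dual_left B x (D y) + dual_right B (D x) y)"

definition inner_derivation ::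
  "('k::real_normed_field, 'v::ab_group_add, 'e) nalgebra_scheme
    \<Rightarrow> ('v \<Rightarrow> ('v \<Rightarrow> 'k)) \<Rightarrow> bool" where
  "inner_derivation B D \<longleftrightarrow>
     (\<exists>f\<in>carr (dual B). \<forall>a\<in>carr B. D a = dual_left B a f - dual_right B f a)"

definition weakly_amenable ::
  "('k::real_normed_field, 'v::ab_group_add, 'e) nalgebra_scheme \<Rightarrow> bool" where
  "weakly_amenable B \<longleftrightarrow> (\<forall>D. bounded_derivation B D \<longrightarrow> inner_derivation B D)"

text \<open>
  The first Arens product: \<open>(a'' a')(a) = a'' (a' a)\<close> and \<open>(a'' b'')(a') = a'' (b'' a')\<close>.
\<close>

definition bidual_act ::
  "('k::real_normed_field, 'v, 'e) nalgebra_scheme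
    \<Rightarrow> (('v \<Rightarrow> 'k) \<Rightarrow> 'k) \<Rightarrow> ('v \<Rightarrow> 'k) \<Rightarrow> ('v \<Rightarrow> 'k)" where
  "bidual_act A F f = (\<lambda>a. if a \<in> carr A then F (dual_right A f a) else 0)"

definition arens ::
  "('k::real_normed_field, 'v::ab_group_add, 'e) nalgebra_scheme
    \<Rightarrow> (('v \<Rightarrow> 'k) \<Rightarrow> 'k) \<Rightarrow> (('v \<Rightarrow> 'k) \<Rightarrow> 'k) \<Rightarrow> (('v \<Rightarrow> 'k) \<Rightarrow> 'k)" where
  "arens A F G = (\<lambda>f. if f \<in> carr (dual A) then F (bidual_act A G f) else 0)"

definition bidual_algebra ::
  "('k::real_normed_field, 'v::ab_group_add, 'e) nalgebra_scheme
    \<Rightarrow> ('k, ('v \<Rightarrow> 'k) \<Rightarrow> 'k) nalgebra" where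
  "bidual_algebra A =
    \<lparr>carr = carr (dual (dual A)), smul = smul (dual (dual A)), nrm = nrm (dual (dual A)),
     mul = arens A\<rparr>"

definition initial_topology :: "'x set \<Rightarrow> ('x \<Rightarrow> 'k::topological_space) set \<Rightarrow> 'x topology" where
  "initial_topology X \<Phi> = topology_generated_by {{x \<in> X. \<phi> x \<in> U} | \<phi> U. \<phi> \<in> \<Phi> \<and> open U}"

definition weak_topology ::
  "('k::real_normed_field, 'v::ab_group_add, 'e) nspace_scheme \<Rightarrow> 'v topology" where
  "weak_topology V = initial_topology (carr V) (carr (dual V))"

definition weak_star_topology ::
  "('k::real_normed_field, 'v::ab_group_add, 'e) nspace_scheme \<Rightarrow> ('v \<Rightarrow> 'k) topology" where
  "weak_star_topology V =
     initial_topology (carr (dual V)) ((\<lambda>x f. f x) ` carr V)"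

definition bidual_I_wsw ::
  "('k::real_normed_field, 'v::ab_group_add, 'e) nalgebra_scheme \<Rightarrow> bool" where
  "bidual_I_wsw A \<longleftrightarrow>
     (\<forall>F\<in>carr (dual (dual A)).
        continuous_map (weak_star_topology (dual A)) (weak_topology (dual (dual A)))
          (\<lambda>G. arens A F G))"

end

theory Submission imports Defs begin

text \<open>
  Let \<open>D\<close> be a bounded derivation from \<open>A\<close> to its dual. It is extended to the bidual by its second
  transpose \<open>D''\<close>, given by \<open>\<langle>D''(F), H\<rangle> = \<langle>F, a \<mapsto> \<langle>H, D a\<rangle>\<rangle>\<close>. If \<open>D''\<close> is a derivation, then weak
  amenability of the bidual provides a functional \<open>\<phi>\<close> on the bidual implementing \<open>D''\<close>, and since \<open>A\<close>
  embeds multiplicatively into its bidual, the restriction of \<open>\<phi>\<close> to \<open>A\<close> implements \<open>D\<close>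
  (\<open>inner_if_second_transpose_inner\<close>).

  The point is therefore that \<open>D''\<close> is a derivation (\<open>second_transpose_arens\<close>). Evaluate \<open>D''(F G)\<close>
  at \<open>H\<close>, unfold the Arens product, in which \<open>G\<close> acts before \<open>F\<close>, and apply the derivation rule to
  \<open>D (a b)\<close>. The summand \<open>D(a) b\<close> gives \<open>\<langle>D''(F), G H\<rangle>\<close> directly. The summand \<open>a D(b)\<close> gives \<open>F\<close> applied
  to the functional \<open>a \<mapsto> \<langle>D''(G), H a\<rangle>\<close>, whereas the derivation rule demands \<open>\<langle>D''(G), H F\<rangle>\<close>. These agree
  because of the \<open>I\<close>-\<open>w\<^sup>*w\<close> property: it makes \<open>F \<mapsto> \<langle>D''(G), H F\<rangle>\<close> a weak-star continuous functional,
  and such a functional is the evaluation at some element of the dual of \<open>A\<close>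
  (\<open>weak_star_continuous_eq_evaluation\<close>, \<open>wsw_functional_eval\<close>), which is determined by its values on
  the image of \<open>A\<close>.
\<close>

section \<open>Spaces and their duals\<close>

text \<open>
  The fragment of the normed space axioms from which the operator norm controls functionals. It
  passes from a space to its dual, so one set of lemmas serves \<open>A\<close> and all its iterated duals.
\<close>

locale homogeneous_space =
  fixes V :: "('k::real_normed_field, 'v::ab_group_add, 'e) nspace_scheme"
  assumes zero_carr: "0 \<in> carr V"
    and add_carr: "x \<in> carr V \<Longrightarrow> y \<in> carr V \<Longrightarrow> x + y \<in> carr V"
    and smul_carr: "x \<in> carr V \<Longrightarrow> smul V c x \<in> carr V"
    and smul_0: "x \<in> carr V \<Longrightarrow> smul V 0 x = 0"
    and nrm_nonneg: "x \<in> carr V \<Longrightarrow> 0 \<le> nrm V x"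
    and nrm_smul: "x \<in> carr V \<Longrightarrow> nrm V (smul V c x) = norm c * nrm V x"

lemma smul_dual [simp]: "smul (dual V) c f = (\<lambda>x. c * f x)"
  by (simp add: dual_def)

lemma dualI:
  assumes "\<And>x y. x \<in> carr V \<Longrightarrow> y \<in> carr V \<Longrightarrow> f (x + y) = f x + f y"
    and "\<And>c x. x \<in> carr V \<Longrightarrow> f (smul V c x) = c * f x"
    and "\<And>x. x \<in> carr V \<Longrightarrow> norm (f x) \<le> M * nrm V x"
    and "\<And>x. x \<notin> carr V \<Longrightarrow> f x = 0"
  shows "f \<in> carr (dual V)"
  unfolding dual_def bounded_linear_between_def scalars_def
  using assms by (simp; intro exI[of _ M]; simp)

lemma dual_add:
  "f \<in> carr (dual V) \<Longrightarrow> x \<in> carr V \<Longrightarrow> y \<in> carr V \<Longrightarrow> f (x + y) = f x + f y"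
  by (simp add: dual_def bounded_linear_between_def scalars_def)

lemma dual_smul: "f \<in> carr (dual V) \<Longrightarrow> x \<in> carr V \<Longrightarrow> f (smul V c x) = c * f x"
  by (simp add: dual_def bounded_linear_between_def scalars_def)

lemma dual_outside: "f \<in> carr (dual V) \<Longrightarrow> x \<notin> carr V \<Longrightarrow> f x = 0"
  by (simp add: dual_def)

context homogeneous_space
begin

lemma nrm_0 [simp]: "nrm V 0 = 0"
  using nrm_smul[OF zero_carr, of 0] smul_0[OF zero_carr] by simp

lemma dual_norm_bound:
  assumes f: "f \<in> carr (dual V)" and x: "x \<in> carr V"
  shows "norm (f x) \<le> nrm (dual V) f * nrm V x"
proof -
  obtain M where M: "\<And>x. x \<in> carr V \<Longrightarrow> norm (f x) \<le> M * nrm V x"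
    using f by (simp add: dual_def bounded_linear_between_def scalars_def) blast
  show ?thesis
  proof (cases "nrm V x = 0")
    case True
    then show ?thesis using M[OF x] by simp
  next
    case False
    then have pos: "nrm V x > 0" using nrm_nonneg[OF x] by simp
    \<comment> \<open>The operator norm only sees the unit ball, so \<open>x\<close> is rescaled into it.\<close>
    define u where "u = smul V (of_real (1 / nrm V x)) x"
    have u: "u \<in> carr V" "nrm V u \<le> 1"
      using x pos by (auto simp: u_def smul_carr nrm_smul norm_divide)
    have "norm (f y) \<le> \<bar>M\<bar>" if "y \<in> carr V" "nrm V y \<le> 1" for y
    proof -
      have "norm (f y) \<le> \<bar>M\<bar> * nrm V y"
        using M[OF that(1)] nrm_nonneg[OF that(1)]
        by (meson abs_ge_self mult_right_mono order_trans)
      also have "\<dots> \<le> \<bar>M\<bar>" using that by (simp add: mult_left_le)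
      finally show ?thesis .
    qed
    then have "bdd_above ((\<lambda>x. norm (f x)) ` {x \<in> carr V. nrm V x \<le> 1})"
      by (auto simp: bdd_above_def)
    then have "norm (f u) \<le> nrm (dual V) f"
      using u by (auto simp: dual_def intro!: cSUP_upper)
    moreover have "norm (f u) = norm (f x) / nrm V x"
      unfolding u_def using pos
      by (simp add: dual_smul[OF f x] norm_mult norm_divide)
    ultimately show ?thesis using pos by (simp add: field_simps)
  qed
qed

lemma nrm_dual_le:
  assumes "\<And>x. x \<in> carr V \<Longrightarrow> norm (f x) \<le> M * nrm V x" and "0 \<le> M"
  shows "nrm (dual V) f \<le> M"
proof -
  have "norm (f x) \<le> M" if "x \<in> carr V" "nrm V x \<le> 1" for x
    using assms(1)[OF that(1)] that(2) \<open>0 \<le> M\<close> by (meson mult_left_le order_trans)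
  then show ?thesis
    using zero_carr by (auto simp: dual_def intro!: cSUP_least)
qed

lemma nrm_dual_nonneg:
  assumes f: "f \<in> carr (dual V)"
  shows "0 \<le> nrm (dual V) f"
proof (cases "\<exists>x\<in>carr V. nrm V x \<noteq> 0")
  case True
  then obtain x where x: "x \<in> carr V" "nrm V x > 0" using nrm_nonneg by force
  have "0 \<le> nrm (dual V) f * nrm V x"
    using dual_norm_bound[OF f x(1)] norm_ge_zero order_trans by blast
  then show ?thesis using x(2) by (simp add: zero_le_mult_iff)
next
  case False
  have "norm (f x) = 0" if "x \<in> carr V" for x
    using dual_norm_bound[OF f that] False that by simp
  then have "(\<lambda>x. norm (f x)) ` {x \<in> carr V. nrm V x \<le> 1} = {0}"
    using zero_carr by force
  then show ?thesis by (simp add: dual_def)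
qed

lemma zero_dual: "0 \<in> carr (dual V)"
  by (rule dualI[where M = 0]) auto

lemma smul_in_dual:
  assumes f: "f \<in> carr (dual V)"
  shows "(\<lambda>x. c * f x) \<in> carr (dual V)"
proof (rule dualI[where M = "norm c * nrm (dual V) f"])
  show "norm (c * f x) \<le> norm c * nrm (dual V) f * nrm V x" if "x \<in> carr V" for x
    using dual_norm_bound[OF f that] by (simp add: norm_mult mult_left_mono mult.assoc)
qed (auto simp: dual_add[OF f] dual_smul[OF f] dual_outside[OF f] algebra_simps)

lemma add_in_dual:
  assumes f: "f \<in> carr (dual V)" and g: "g \<in> carr (dual V)"
  shows "f + g \<in> carr (dual V)"
proof (rule dualI[where M = "nrm (dual V) f + nrm (dual V) g"])
  show "norm ((f + g) x) \<le> (nrm (dual V) f + nrm (dual V) g) * nrm V x" if "x \<in> carr V" for x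
    using dual_norm_bound[OF f that] dual_norm_bound[OF g that] norm_triangle_ineq[of "f x" "g x"]
    by (simp add: distrib_right)
qed (auto simp: dual_add[OF f] dual_smul[OF f] dual_outside[OF f]
      dual_add[OF g] dual_smul[OF g] dual_outside[OF g] algebra_simps)

lemma nrm_dual_smul_le:
  assumes f: "f \<in> carr (dual V)"
  shows "nrm (dual V) (\<lambda>x. c * f x) \<le> norm c * nrm (dual V) f"
proof (rule nrm_dual_le)
  show "norm (c * f x) \<le> norm c * nrm (dual V) f * nrm V x" if "x \<in> carr V" for x
    using dual_norm_bound[OF f that] by (simp add: norm_mult mult_left_mono mult.assoc)
qed (simp add: nrm_dual_nonneg[OF f])

lemma nrm_dual_smul:
  assumes f: "f \<in> carr (dual V)"
  shows "nrm (dual V) (\<lambda>x. c * f x) = norm c * nrm (dual V) f"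
proof (rule antisym)
  show "norm c * nrm (dual V) f \<le> nrm (dual V) (\<lambda>x. c * f x)"
  proof (cases "c = 0")
    case True
    then show ?thesis using nrm_dual_nonneg[OF smul_in_dual[OF f, of c]] by simp
  next
    case False
    have "nrm (dual V) f = nrm (dual V) (\<lambda>x. inverse c * (c * f x))"
      using False by (simp add: mult.assoc[symmetric])
    also have "\<dots> \<le> norm (inverse c) * nrm (dual V) (\<lambda>x. c * f x)"
      by (rule nrm_dual_smul_le[OF smul_in_dual[OF f]])
    also have "norm (inverse c) = inverse (norm c)" by (rule norm_inverse)
    finally show ?thesis using False by (simp add: field_simps)
  qed
qed (rule nrm_dual_smul_le[OF f])

lemma homogeneous_space_dual: "homogeneous_space (dual V)"
  by unfold_locales
    (auto simp: zero_dual add_in_dual smul_in_dual nrm_dual_nonneg nrm_dual_smul)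

end


section \<open>Weak-star continuous functionals\<close>

text \<open>
  The generating sets of the weak-star topology are only a subbase; the finite sets of test vectors
  arise from the finite intersections.
\<close>

lemma weak_star_open_contains_basic:
  assumes "openin (weak_star_topology V) W" and "F\<^sub>0 \<in> W"
  shows "\<exists>S e. finite S \<and> S \<subseteq> carr V \<and> e > 0 \<and>
    (\<forall>F\<in>carr (dual V). (\<forall>x\<in>S. norm (F x - F\<^sub>0 x) < e) \<longrightarrow> F \<in> W)"
proof -
  have "generate_topology_on
      {{F \<in> carr (dual V). \<phi> F \<in> U} | \<phi> U. \<phi> \<in> (\<lambda>x f. f x) ` carr V \<and> open U} W"
    using assms(1)
    by (simp add: weak_star_topology_def initial_topology_def openin_topology_generated_by_iff)
  then show ?thesis using assms(2)
  proof (induction rule: generate_topology_on.induct)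
    case Empty
    then show ?case by simp
  next
    case (Int a b)
    obtain S e where S: "finite S" "S \<subseteq> carr V" "e > 0"
      "\<forall>F\<in>carr (dual V). (\<forall>x\<in>S. norm (F x - F\<^sub>0 x) < e) \<longrightarrow> F \<in> a"
      using Int by blast
    obtain T d where T: "finite T" "T \<subseteq> carr V" "d > 0"
      "\<forall>F\<in>carr (dual V). (\<forall>x\<in>T. norm (F x - F\<^sub>0 x) < d) \<longrightarrow> F \<in> b"
      using Int by blast
    show ?case
      by (rule exI[of _ "S \<union> T"], rule exI[of _ "min e d"]) (use S T in auto)
  next
    case (UN K)
    then obtain k where "k \<in> K" "F\<^sub>0 \<in> k" by blast
    with UN.IH[of k] show ?case by (metis UnionI)
  next
    case (Basis s)
    then obtain x U where x: "x \<in> carr V" "open U" "s = {F \<in> carr (dual V). F x \<in> U}"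
      by blast
    then obtain e where "e > 0" "ball (F\<^sub>0 x) e \<subseteq> U"
      using Basis.prems open_contains_ball by blast
    then have "finite {x} \<and> {x} \<subseteq> carr V \<and> e > 0 \<and>
        (\<forall>F\<in>carr (dual V). (\<forall>y\<in>{x}. norm (F y - F\<^sub>0 y) < e) \<longrightarrow> F \<in> s)"
      using x by (auto simp: subset_iff dist_norm norm_minus_commute)
    then show ?case by blast
  qed
qed

context homogeneous_space
begin

text \<open>
  Linear algebra behind the duality: a linear form that vanishes where finitely many evaluations do
  is a combination of these evaluations, hence itself an evaluation. The induction removes one
  test vector \<open>y\<close> by passing to the subspace of those \<open>F\<close> with \<open>F y = 0\<close>, which is why the statement
  ranges over subspaces \<open>W\<close> of the dual.
\<close>

lemma functional_eq_evaluation: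
  assumes "finite S" "S \<subseteq> carr V" "W \<subseteq> carr (dual V)"
    and "\<And>F G. F \<in> W \<Longrightarrow> G \<in> W \<Longrightarrow> F + G \<in> W"
    and "\<And>c F. F \<in> W \<Longrightarrow> (\<lambda>x. c * F x) \<in> W"
    and "\<And>F G. F \<in> W \<Longrightarrow> G \<in> W \<Longrightarrow> \<psi> (F + G) = \<psi> F + \<psi> G"
    and "\<And>c F. F \<in> W \<Longrightarrow> \<psi> (\<lambda>x. c * F x) = c * \<psi> F"
    and "\<And>F. F \<in> W \<Longrightarrow> \<forall>x\<in>S. F x = 0 \<Longrightarrow> \<psi> F = 0"
  shows "\<exists>x\<in>carr V. \<forall>F\<in>W. \<psi> F = F x"
  using assms
proof (induction S arbitrary: W rule: finite_induct)
  case empty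
  have "F 0 = 0" if "F \<in> W" for F
    using dual_add[of F V 0 0] that empty.prems(2) zero_carr by auto
  then show ?case using empty zero_carr by (intro bexI[of _ 0]) auto
next
  case (insert y S)
  note lin = insert.prems(3-6)
  let ?W' = "{F \<in> W. F y = 0}"
  have "\<exists>x\<in>carr V. \<forall>F\<in>?W'. \<psi> F = F x"
    by (rule insert.IH) (use insert.prems in auto)
  then obtain x where x: "x \<in> carr V" and eq: "\<And>F. F \<in> W \<Longrightarrow> F y = 0 \<Longrightarrow> \<psi> F = F x"
    by auto
  show ?case
  proof (cases "\<forall>F\<in>W. F y = 0")
    case True
    then show ?thesis using x eq by blast
  next
    case False
    then obtain E where E: "E \<in> W" "E y \<noteq> 0" by blast
    define k where "k = (\<psi> E - E x) / E y"
    have y: "y \<in> carr V" using insert.prems(1) by simp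
    have "\<psi> F = F (x + smul V k y)" if F: "F \<in> W" for F
    proof -
      \<comment> \<open>Adding this multiple of \<open>E\<close> projects \<open>F\<close> into the subspace covered by induction.\<close>
      define t where "t = - F y / E y"
      have tE: "(\<lambda>x. t * E x) \<in> W" using lin(2) E by blast
      have "\<psi> (F + (\<lambda>x. t * E x)) = (F + (\<lambda>x. t * E x)) x"
        by (rule eq[OF lin(1)[OF F tE]]) (use E(2) in \<open>simp add: t_def\<close>)
      then have "\<psi> F + t * \<psi> E = F x + t * E x"
        using lin(3)[OF F tE] lin(4)[OF E(1)] by simp
      then have "\<psi> F = F x + k * F y"
        using E(2) by (simp add: t_def k_def field_simps)
      moreover have "F \<in> carr (dual V)" using F insert.prems(2) by blast
      ultimately show ?thesis
        using x y by (simp add: dual_add smul_carr dual_smul)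
    qed
    moreover have "x + smul V k y \<in> carr V" using x y by (simp add: add_carr smul_carr)
    ultimately show ?thesis by blast
  qed
qed

text \<open>
  Continuity at \<open>0\<close> bounds \<open>\<psi>\<close> by \<open>1\<close> on a basic neighbourhood of \<open>0\<close>. That neighbourhood contains the
  subspace on which its finitely many test vectors vanish, and a linear form bounded on a subspace
  is zero there.
\<close>

lemma weak_star_continuous_eq_evaluation:
  assumes cont: "continuous_map (weak_star_topology V) euclidean \<psi>"
    and add: "\<And>F G. F \<in> carr (dual V) \<Longrightarrow> G \<in> carr (dual V) \<Longrightarrow> \<psi> (F + G) = \<psi> F + \<psi> G"
    and smul: "\<And>c F. F \<in> carr (dual V) \<Longrightarrow> \<psi> (\<lambda>x. c * F x) = c * \<psi> F"
  shows "\<exists>x\<in>carr V. \<forall>F\<in>carr (dual V). \<psi> F = F x"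
proof -
  let ?W = "{F \<in> topspace (weak_star_topology V). \<psi> F \<in> ball 0 1}"
  have "openin (weak_star_topology V) ?W"
    by (rule openin_continuous_map_preimage[OF cont]) simp
  moreover have "\<psi> 0 = 0" using add[OF zero_dual zero_dual] by simp
  moreover have "0 \<in> topspace (weak_star_topology V)"
  proof -
    have "openin (weak_star_topology V) {F \<in> carr (dual V). (\<lambda>f. f 0) F \<in> UNIV}"
      unfolding weak_star_topology_def initial_topology_def
      by (rule topology_generated_by_Basis) (use zero_carr in blast)
    then show ?thesis using zero_dual openin_subset by fastforce
  qed
  ultimately obtain S e where S: "finite S" "S \<subseteq> carr V" "e > 0"
    and nb: "\<And>F. F \<in> carr (dual V) \<Longrightarrow> \<forall>x\<in>S. norm (F x) < e \<Longrightarrow> F \<in> ?W"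
    using weak_star_open_contains_basic[of V ?W 0] by auto
  have "\<psi> F = 0" if F: "F \<in> carr (dual V)" and 0: "\<forall>x\<in>S. F x = 0" for F
  proof (rule ccontr)
    assume "\<psi> F \<noteq> 0"
    \<comment> \<open>This multiple of \<open>F\<close> has \<open>\<psi>\<close>-value exactly \<open>1\<close>, so it lies outside \<open>?W\<close>.\<close>
    have "(\<lambda>x. inverse (\<psi> F) * F x) \<in> ?W"
      by (rule nb) (use F 0 S smul_in_dual in auto)
    then show False using smul[OF F] \<open>\<psi> F \<noteq> 0\<close> by simp
  qed
  then show ?thesis
    by (intro functional_eq_evaluation[OF S(1,2) order_refl add_in_dual smul_in_dual add smul])
qed

lemma continuous_map_weak_topology_functional:
  assumes "\<phi> \<in> carr (dual V)"
  shows "continuous_map (weak_topology V) euclidean \<phi>"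
proof -
  have top: "topspace (weak_topology V) = carr V"
    using zero_dual
    by (auto simp: weak_topology_def initial_topology_def intro!: exI[of _ UNIV])
  show ?thesis
    unfolding continuous_map_def top using assms
    by (auto simp: weak_topology_def initial_topology_def intro!: topology_generated_by_Basis)
qed

end


section \<open>The Arens product on the bidual\<close>

lemma dual_bidual_algebra: "dual (bidual_algebra A) = dual (dual (dual A))"
  by (simp add: dual_def bidual_algebra_def bounded_linear_between_def)

lemma carr_bidual_algebra [simp]: "carr (bidual_algebra A) = carr (dual (dual A))"
  and mul_bidual_algebra [simp]: "mul (bidual_algebra A) = arens A"
  by (simp_all add: bidual_algebra_def)

context banach_algebra_over
begin

abbreviation "A \<equiv> algebra_of scl"

lemma A_simps [simp]: "carr A = UNIV" "smul A = scl" "nrm A = norm" "mul A = (*)"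
  by (simp_all add: algebra_of_def)

sublocale A: homogeneous_space A
  by unfold_locales (auto simp: norm_scl)

sublocale A': homogeneous_space "dual A"
  by (rule A.homogeneous_space_dual)

sublocale A'': homogeneous_space "dual (dual A)"
  by (rule A'.homogeneous_space_dual)

definition canon :: "'a \<Rightarrow> ('a \<Rightarrow> 'k) \<Rightarrow> 'k" where
  "canon a = (\<lambda>f. if f \<in> carr (dual A) then f a else 0)"

lemma canon_in_bidual: "canon a \<in> carr (dual (dual A))"
proof (rule dualI[where M = "norm a"])
  show "norm (canon a f) \<le> norm a * nrm (dual A) f" if "f \<in> carr (dual A)" for f
    using A.dual_norm_bound[OF that, of a] that by (simp add: canon_def mult.commute)
qed (use A'.add_carr A'.smul_carr in \<open>auto simp: canon_def\<close>)

lemma dual_right_in_dual: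
  assumes f: "f \<in> carr (dual A)"
  shows "dual_right A f a \<in> carr (dual A)"
    and "nrm (dual A) (dual_right A f a) \<le> nrm (dual A) f * norm a"
proof -
  have b: "norm (dual_right A f a x) \<le> (nrm (dual A) f * norm a) * nrm A x" for x
  proof -
    have "norm (f (a * x)) \<le> nrm (dual A) f * norm (a * x)"
      using A.dual_norm_bound[OF f, of "a * x"] by simp
    also have "\<dots> \<le> nrm (dual A) f * (norm a * norm x)"
      by (intro mult_left_mono norm_mult_ineq A.nrm_dual_nonneg f)
    finally show ?thesis by (simp add: dual_right_def mult.assoc)
  qed
  show "dual_right A f a \<in> carr (dual A)"
  proof (rule dualI[where M = "nrm (dual A) f * norm a"])
    show "dual_right A f a (smul A c x) = c * dual_right A f a x" for c x
      using dual_smul[OF f, of "a * x" c] by (simp add: dual_right_def scl_mult_right)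
  qed (use b dual_add[OF f] in \<open>auto simp: dual_right_def algebra_simps\<close>)
  show "nrm (dual A) (dual_right A f a) \<le> nrm (dual A) f * norm a"
    by (rule A.nrm_dual_le) (use b A.nrm_dual_nonneg[OF f] in auto)
qed

lemma dual_left_in_dual:
  assumes f: "f \<in> carr (dual A)"
  shows "dual_left A a f \<in> carr (dual A)"
proof (rule dualI[where M = "nrm (dual A) f * norm a"])
  show "norm (dual_left A a f x) \<le> (nrm (dual A) f * norm a) * nrm A x" for x
  proof -
    have "norm (f (x * a)) \<le> nrm (dual A) f * norm (x * a)"
      using A.dual_norm_bound[OF f, of "x * a"] by simp
    also have "\<dots> \<le> nrm (dual A) f * (norm x * norm a)"
      by (intro mult_left_mono norm_mult_ineq A.nrm_dual_nonneg f)
    finally show ?thesis by (simp add: dual_left_def mult_ac)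
  qed
  show "dual_left A a f (smul A c x) = c * dual_left A a f x" for c x
    using dual_smul[OF f, of "x * a" c] by (simp add: dual_left_def scl_mult_left)
qed (use dual_add[OF f] in \<open>auto simp: dual_left_def algebra_simps\<close>)

lemma bidual_act_in_dual:
  assumes F: "F \<in> carr (dual (dual A))" and f: "f \<in> carr (dual A)"
  shows "bidual_act A F f \<in> carr (dual A)"
    and "nrm (dual A) (bidual_act A F f) \<le> nrm (dual (dual A)) F * nrm (dual A) f"
proof -
  have b: "norm (bidual_act A F f x) \<le> (nrm (dual (dual A)) F * nrm (dual A) f) * nrm A x" for x
  proof -
    have "norm (F (dual_right A f x)) \<le> nrm (dual (dual A)) F * nrm (dual A) (dual_right A f x)"
      using A'.dual_norm_bound[OF F dual_right_in_dual(1)[OF f]] .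
    also have "\<dots> \<le> nrm (dual (dual A)) F * (nrm (dual A) f * norm x)"
      by (intro mult_left_mono dual_right_in_dual(2) A'.nrm_dual_nonneg F f)
    finally show ?thesis by (simp add: bidual_act_def mult.assoc)
  qed
  show "bidual_act A F f \<in> carr (dual A)"
  proof (rule dualI[where M = "nrm (dual (dual A)) F * nrm (dual A) f"])
    show "bidual_act A F f (x + y) = bidual_act A F f x + bidual_act A F f y" for x y
    proof -
      have "dual_right A f (x + y) = dual_right A f x + dual_right A f y"
        using dual_add[OF f] by (auto simp: dual_right_def distrib_right)
      then show ?thesis
        using dual_add[OF F dual_right_in_dual(1)[OF f] dual_right_in_dual(1)[OF f]]
        by (simp add: bidual_act_def)
    qed
    show "bidual_act A F f (smul A c x) = c * bidual_act A F f x" for c x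
    proof -
      have "dual_right A f (scl c x) = smul (dual A) c (dual_right A f x)"
        using dual_smul[OF f] by (auto simp: dual_right_def scl_mult_left)
      then show ?thesis
        using dual_smul[OF F dual_right_in_dual(1)[OF f]] by (simp add: bidual_act_def)
    qed
  qed (use b in auto)
  show "nrm (dual A) (bidual_act A F f) \<le> nrm (dual (dual A)) F * nrm (dual A) f"
    by (rule A.nrm_dual_le) (use b A.nrm_dual_nonneg[OF f] A'.nrm_dual_nonneg[OF F] in auto)
qed

lemma bidual_act_add:
  assumes "G \<in> carr (dual (dual A))" "f \<in> carr (dual A)" "g \<in> carr (dual A)"
  shows "bidual_act A G (f + g) = bidual_act A G f + bidual_act A G g"
proof -
  have "dual_right A (f + g) a = dual_right A f a + dual_right A g a" for a
    by (auto simp: dual_right_def)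
  then show ?thesis
    using assms by (auto simp: bidual_act_def dual_add dual_right_in_dual)
qed

lemma bidual_act_smul:
  assumes "G \<in> carr (dual (dual A))" "f \<in> carr (dual A)"
  shows "bidual_act A G (\<lambda>x. c * f x) = (\<lambda>x. c * bidual_act A G f x)"
proof -
  have "dual_right A (\<lambda>x. c * f x) a = smul (dual A) c (dual_right A f a)" for a
    by (auto simp: dual_right_def)
  then show ?thesis
    using assms dual_smul[OF assms(1) dual_right_in_dual(1)[OF assms(2)]]
    by (auto simp: bidual_act_def)
qed

lemma arens_in_bidual:
  assumes F: "F \<in> carr (dual (dual A))" and G: "G \<in> carr (dual (dual A))"
  shows "arens A F G \<in> carr (dual (dual A))"
proof (rule dualI[where M = "nrm (dual (dual A)) F * nrm (dual (dual A)) G"])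
  fix f g c
  assume f: "f \<in> carr (dual A)"
  show "arens A F G (f + g) = arens A F G f + arens A F G g" if g: "g \<in> carr (dual A)"
    using f g A'.add_carr dual_add[OF F]
    by (simp add: arens_def bidual_act_add[OF G] bidual_act_in_dual[OF G])
  show "arens A F G (smul (dual A) c f) = c * arens A F G f"
    using f A.smul_in_dual dual_smul[OF F bidual_act_in_dual(1)[OF G f]]
    by (simp add: arens_def bidual_act_smul[OF G])
  have "norm (F (bidual_act A G f)) \<le> nrm (dual (dual A)) F * nrm (dual A) (bidual_act A G f)"
    using A'.dual_norm_bound[OF F bidual_act_in_dual(1)[OF G f]] .
  also have "\<dots> \<le> nrm (dual (dual A)) F * (nrm (dual (dual A)) G * nrm (dual A) f)"
    by (intro mult_left_mono bidual_act_in_dual(2) A'.nrm_dual_nonneg F G f)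
  finally show "norm (arens A F G f)
      \<le> (nrm (dual (dual A)) F * nrm (dual (dual A)) G) * nrm (dual A) f"
    using f by (simp add: arens_def mult.assoc)
qed (auto simp: arens_def)

lemma arens_add_right:
  assumes H: "H \<in> carr (dual (dual A))"
    and F: "F \<in> carr (dual (dual A))" and G: "G \<in> carr (dual (dual A))"
  shows "arens A H (F + G) = arens A H F + arens A H G"
proof
  fix f
  have "bidual_act A (F + G) f = bidual_act A F f + bidual_act A G f"
    by (auto simp: bidual_act_def)
  then show "arens A H (F + G) f = (arens A H F + arens A H G) f"
    using dual_add[OF H bidual_act_in_dual(1)[OF F] bidual_act_in_dual(1)[OF G]]
    by (simp add: arens_def)
qed

lemma arens_smul_right:
  assumes H: "H \<in> carr (dual (dual A))" and F: "F \<in> carr (dual (dual A))"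
  shows "arens A H (\<lambda>f. c * F f) = (\<lambda>f. c * arens A H F f)"
proof
  fix f
  have "bidual_act A (\<lambda>f. c * F f) f = smul (dual A) c (bidual_act A F f)"
    by (auto simp: bidual_act_def)
  then show "arens A H (\<lambda>f. c * F f) f = c * arens A H F f"
    using dual_smul[OF H bidual_act_in_dual(1)[OF F]]
    by (simp add: arens_def)
qed

lemma bidual_act_canon:
  assumes "f \<in> carr (dual A)"
  shows "bidual_act A (canon a) f = dual_left A a f"
  using dual_right_in_dual(1)[OF assms]
  by (auto simp: bidual_act_def canon_def dual_left_def dual_right_def)

lemma arens_canon:
  "f \<in> carr (dual A) \<Longrightarrow> arens A H (canon a) f = H (dual_left A a f)"
  by (simp add: arens_def bidual_act_canon)

lemma arens_canon_canon: "arens A (canon a) (canon b) = canon (a * b)"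
proof
  fix f
  show "arens A (canon a) (canon b) f = canon (a * b) f"
  proof (cases "f \<in> carr (dual A)")
    case True
    then have "arens A (canon a) (canon b) f = dual_left A b f a"
      by (simp add: arens_canon dual_left_in_dual canon_def[of a])
    then show ?thesis using True by (simp add: canon_def dual_left_def)
  qed (simp add: arens_def canon_def)
qed

text \<open>
  The only use of the \<open>I\<close>-\<open>w\<^sup>*w\<close> property. It allows \<open>\<phi>\<close> to be interchanged with the weak-star limit
  along which elements of \<open>A\<close> approach \<open>F\<close>; instead of taking limits, \<open>\<phi> \<circ> arens A H\<close> is recognised as
  the evaluation at an element of the dual of \<open>A\<close>, and this element is computed by inserting \<open>canon a\<close>.
\<close>

lemma wsw_functional_eval:
  assumes wsw: "bidual_I_wsw A"
    and H: "H \<in> carr (dual (dual A))" and F: "F \<in> carr (dual (dual A))"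
    and \<phi>: "\<phi> \<in> carr (dual (dual (dual A)))"
  shows "(\<lambda>a. \<phi> (arens A H (canon a))) \<in> carr (dual A)"
    and "F (\<lambda>a. \<phi> (arens A H (canon a))) = \<phi> (arens A H F)"
proof -
  have "continuous_map (weak_star_topology (dual A)) euclidean (\<phi> \<circ> arens A H)"
    using wsw H A''.continuous_map_weak_topology_functional[OF \<phi>]
    by (auto simp: bidual_I_wsw_def intro: continuous_map_compose)
  then have "\<exists>f\<in>carr (dual A). \<forall>F\<in>carr (dual (dual A)). (\<phi> \<circ> arens A H) F = F f"
  proof (rule A'.weak_star_continuous_eq_evaluation)
    fix F G c assume F: "F \<in> carr (dual (dual A))"
    show "(\<phi> \<circ> arens A H) (F + G) = (\<phi> \<circ> arens A H) F + (\<phi> \<circ> arens A H) G"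
      if "G \<in> carr (dual (dual A))"
      using F that by (simp add: arens_add_right[OF H] dual_add[OF \<phi>] arens_in_bidual[OF H])
    show "(\<phi> \<circ> arens A H) (\<lambda>x. c * F x) = c * (\<phi> \<circ> arens A H) F"
      using F dual_smul[OF \<phi> arens_in_bidual[OF H F]] by (simp add: arens_smul_right[OF H])
  qed
  then obtain f where f: "f \<in> carr (dual A)"
    and eq: "\<And>F. F \<in> carr (dual (dual A)) \<Longrightarrow> \<phi> (arens A H F) = F f" by auto
  have "\<phi> (arens A H (canon a)) = f a" for a
    using eq[OF canon_in_bidual] f by (simp add: canon_def)
  then show "(\<lambda>a. \<phi> (arens A H (canon a))) \<in> carr (dual A)"
    and "F (\<lambda>a. \<phi> (arens A H (canon a))) = \<phi> (arens A H F)"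
    using f eq[OF F] by simp_all
qed


section \<open>The second transpose of a derivation\<close>

definition transpose :: "('a \<Rightarrow> 'a \<Rightarrow> 'k) \<Rightarrow> (('a \<Rightarrow> 'k) \<Rightarrow> 'k) \<Rightarrow> 'a \<Rightarrow> 'k" where
  "transpose D H = (\<lambda>a. H (D a))"

definition second_transpose ::
  "('a \<Rightarrow> 'a \<Rightarrow> 'k) \<Rightarrow> (('a \<Rightarrow> 'k) \<Rightarrow> 'k) \<Rightarrow> (('a \<Rightarrow> 'k) \<Rightarrow> 'k) \<Rightarrow> 'k" where
  "second_transpose D F = (\<lambda>H. if H \<in> carr (dual (dual A)) then F (transpose D H) else 0)"

context
  fixes D :: "'a \<Rightarrow> 'a \<Rightarrow> 'k"
  assumes D: "bounded_derivation A D"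
begin

lemma D_in: "D a \<in> carr (dual A)"
  and D_add: "D (a + b) = D a + D b"
  and D_scl: "D (scl c a) = smul (dual A) c (D a)"
  and D_mult: "D (a * b) = dual_left A a (D b) + dual_right A (D a) b"
  using D by (auto simp: bounded_derivation_def bounded_linear_between_def)

lemma D_bound: "\<exists>M\<ge>0. \<forall>a. nrm (dual A) (D a) \<le> M * norm a"
proof -
  obtain M where M: "\<And>a. nrm (dual A) (D a) \<le> M * norm a"
    using D by (auto simp: bounded_derivation_def bounded_linear_between_def)
  have "nrm (dual A) (D a) \<le> \<bar>M\<bar> * norm a" for a
    using M[of a] by (meson abs_ge_self mult_right_mono norm_ge_zero order_trans)
  then show ?thesis by (intro exI[of _ "\<bar>M\<bar>"]) auto
qed

lemma transpose_bounded:
  "\<exists>M\<ge>0. \<forall>H\<in>carr (dual (dual A)).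
     transpose D H \<in> carr (dual A) \<and> nrm (dual A) (transpose D H) \<le> M * nrm (dual (dual A)) H"
proof -
  obtain M where M: "M \<ge> 0" "\<And>a. nrm (dual A) (D a) \<le> M * norm a" using D_bound by blast
  have "transpose D H \<in> carr (dual A) \<and> nrm (dual A) (transpose D H) \<le> M * nrm (dual (dual A)) H"
    if H: "H \<in> carr (dual (dual A))" for H
  proof -
    have b: "norm (transpose D H x) \<le> M * nrm (dual (dual A)) H * nrm A x" for x
    proof -
      have "norm (H (D x)) \<le> nrm (dual (dual A)) H * nrm (dual A) (D x)"
        using A'.dual_norm_bound[OF H D_in] .
      also have "\<dots> \<le> nrm (dual (dual A)) H * (M * norm x)"
        by (intro mult_left_mono M A'.nrm_dual_nonneg H)
      finally show ?thesis by (simp add: transpose_def mult_ac)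
    qed
    have "transpose D H \<in> carr (dual A)"
    proof (rule dualI[OF _ _ b])
      show "transpose D H (x + y) = transpose D H x + transpose D H y" for x y
        using dual_add[OF H D_in D_in] by (simp add: transpose_def D_add)
      show "transpose D H (smul A c x) = c * transpose D H x" for c x
        using dual_smul[OF H D_in] by (simp add: transpose_def D_scl del: smul_dual)
    qed simp
    moreover have "nrm (dual A) (transpose D H) \<le> M * nrm (dual (dual A)) H"
      by (rule A.nrm_dual_le[OF b]) (use M A'.nrm_dual_nonneg[OF H] in auto)
    ultimately show ?thesis by blast
  qed
  then show ?thesis using M(1) by blast
qed

lemma transpose_in: "H \<in> carr (dual (dual A)) \<Longrightarrow> transpose D H \<in> carr (dual A)"
  using transpose_bounded by blast

lemma second_transpose_bounded_linear:
  "bounded_linear_between (bidual_algebra A) (dual (bidual_algebra A)) (second_transpose D)"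
proof -
  obtain M where M: "M \<ge> 0"
    "\<And>H. H \<in> carr (dual (dual A)) \<Longrightarrow> nrm (dual A) (transpose D H) \<le> M * nrm (dual (dual A)) H"
    using transpose_bounded by blast
  have b: "norm (second_transpose D F H)
      \<le> (M * nrm (dual (dual A)) F) * nrm (dual (dual A)) H"
    if F: "F \<in> carr (dual (dual A))" and H: "H \<in> carr (dual (dual A))" for F H
  proof -
    have "norm (F (transpose D H)) \<le> nrm (dual (dual A)) F * nrm (dual A) (transpose D H)"
      using A'.dual_norm_bound[OF F transpose_in[OF H]] .
    also have "\<dots> \<le> nrm (dual (dual A)) F * (M * nrm (dual (dual A)) H)"
      by (intro mult_left_mono M A'.nrm_dual_nonneg F H)
    finally show ?thesis using H by (simp add: second_transpose_def mult_ac)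
  qed
  have "second_transpose D F \<in> carr (dual (dual (dual A)))"
    if F: "F \<in> carr (dual (dual A))" for F
  proof (rule dualI[OF _ _ b[OF F]])
    fix H K c assume H: "H \<in> carr (dual (dual A))"
    show "second_transpose D F (H + K) = second_transpose D F H + second_transpose D F K"
      if K: "K \<in> carr (dual (dual A))"
    proof -
      have "transpose D (H + K) = transpose D H + transpose D K"
        by (auto simp: transpose_def)
      then show ?thesis
        using H K A''.add_carr dual_add[OF F transpose_in[OF H] transpose_in[OF K]]
        by (simp add: second_transpose_def)
    qed
    show "second_transpose D F (smul (dual (dual A)) c H) = c * second_transpose D F H"
    proof -
      have "transpose D (\<lambda>f. c * H f) = smul (dual A) c (transpose D H)"
        by (auto simp: transpose_def)
      then show ?thesis
        using H A'.smul_in_dual dual_smul[OF F transpose_in[OF H]]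
        by (simp add: second_transpose_def)
    qed
  qed (auto simp: second_transpose_def)
  moreover have "nrm (dual (dual (dual A))) (second_transpose D F) \<le> M * nrm (dual (dual A)) F"
    if F: "F \<in> carr (dual (dual A))" for F
    by (rule A''.nrm_dual_le[OF b[OF F]]) (use M A'.nrm_dual_nonneg[OF F] in auto)
  ultimately show ?thesis
    unfolding bounded_linear_between_def dual_bidual_algebra carr_bidual_algebra
    by (auto simp: bidual_algebra_def second_transpose_def)
qed

text \<open>
  The derivation rule for the second transpose, evaluated at \<open>H\<close>: the first summand is
  \<open>F \<cdot> D''(G)\<close> and the second \<open>D''(F) \<cdot> G\<close>. Applying \<open>G\<close> in the variable \<open>b\<close> to the
  two parts of \<open>D (a * b)\<close> is mere unfolding, as \<open>b\<close> is the innermost variable of each Arens product;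
  applying \<open>F\<close> in \<open>a\<close> to the part \<open>a D(b)\<close> is the step that rests on \<open>wsw_functional_eval\<close>.
\<close>

lemma second_transpose_arens:
  assumes wsw: "bidual_I_wsw A"
    and F: "F \<in> carr (dual (dual A))" and G: "G \<in> carr (dual (dual A))"
    and H: "H \<in> carr (dual (dual A))"
  shows "second_transpose D (arens A F G) H
    = second_transpose D G (arens A H F) + second_transpose D F (arens A G H)"
proof -
  have G'': "second_transpose D G \<in> carr (dual (dual (dual A)))"
    using second_transpose_bounded_linear G
    by (simp add: bounded_linear_between_def dual_bidual_algebra)
  note Ha = arens_in_bidual[OF H canon_in_bidual]
  have GH: "arens A G H \<in> carr (dual (dual A))" by (rule arens_in_bidual[OF G H])
  have "bidual_act A G (transpose D H) a
      = second_transpose D G (arens A H (canon a)) + transpose D (arens A G H) a" for a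
  proof -
    have "dual_right A (transpose D H) a
        = transpose D (arens A H (canon a)) + bidual_act A H (D a)"
    proof
      fix b
      have "H (D (a * b)) = H (dual_left A a (D b)) + H (dual_right A (D a) b)"
        by (simp add: D_mult dual_add[OF H] D_in dual_left_in_dual dual_right_in_dual)
      then show "dual_right A (transpose D H) a b
          = (transpose D (arens A H (canon a)) + bidual_act A H (D a)) b"
        by (simp add: dual_right_def[of A "transpose D H" a] arens_canon D_in bidual_act_def)
          (simp add: transpose_def arens_canon D_in)
    qed
    then show ?thesis
      using dual_add[OF G transpose_in[OF Ha] bidual_act_in_dual(1)[OF H D_in]]
        Ha D_in by (simp add: bidual_act_def[of A G] second_transpose_def transpose_def
          arens_def[of A G H])
  qed
  then have "bidual_act A G (transpose D H)
      = (\<lambda>a. second_transpose D G (arens A H (canon a))) + transpose D (arens A G H)"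
    by auto
  then have "arens A F G (transpose D H)
      = second_transpose D G (arens A H F) + F (transpose D (arens A G H))"
    using dual_add[OF F wsw_functional_eval(1)[OF wsw H F G''] transpose_in[OF GH]]
      wsw_functional_eval(2)[OF wsw H F G''] transpose_in[OF H]
    by (simp add: arens_def[of A F G])
  then show ?thesis using H GH by (simp add: second_transpose_def[of D "arens A F G"]
        second_transpose_def[of D F])
qed

lemma second_transpose_derivation:
  assumes "bidual_I_wsw A"
  shows "bounded_derivation (bidual_algebra A) (second_transpose D)"
  using second_transpose_bounded_linear second_transpose_arens[OF assms]
  by (auto simp: bounded_derivation_def dual_left_def dual_right_def
      second_transpose_def[of D "arens A _ _"])

text \<open>
  Along the canonical embedding the second transpose restricts to \<open>D\<close> and the Arens product to the
  product of \<open>A\<close>, so a functional implementing the second transpose restricts to one implementing \<open>D\<close>.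
\<close>

lemma inner_if_second_transpose_inner:
  assumes "inner_derivation (bidual_algebra A) (second_transpose D)"
  shows "inner_derivation A D"
proof -
  obtain \<phi> where \<phi>: "\<phi> \<in> carr (dual (dual (dual A)))"
    and inner: "\<And>F. F \<in> carr (dual (dual A)) \<Longrightarrow>
      second_transpose D F = dual_left (bidual_algebra A) F \<phi> - dual_right (bidual_algebra A) \<phi> F"
    using assms by (auto simp: inner_derivation_def dual_bidual_algebra)
  define f where "f = (\<lambda>a. \<phi> (canon a))"
  have "f \<in> carr (dual A)"
  proof (rule dualI[where M = "nrm (dual (dual (dual A))) \<phi>"])
    fix a b c
    have "canon (a + b) = canon a + canon b"
      by (auto simp: canon_def dual_add)
    then show "f (a + b) = f a + f b"
      using dual_add[OF \<phi> canon_in_bidual canon_in_bidual] by (simp add: f_def)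
    have "canon (scl c a) = smul (dual (dual A)) c (canon a)"
      using dual_smul[where V = A] by (auto simp: canon_def)
    then show "f (smul A c a) = c * f a"
      using dual_smul[OF \<phi> canon_in_bidual] by (simp add: f_def)
    have "nrm (dual (dual A)) (canon a) \<le> norm a"
      using A.dual_norm_bound[of _ a]
      by (intro A'.nrm_dual_le) (auto simp: canon_def mult.commute)
    then have "nrm (dual (dual (dual A))) \<phi> * nrm (dual (dual A)) (canon a)
        \<le> nrm (dual (dual (dual A))) \<phi> * norm a"
      by (intro mult_left_mono A''.nrm_dual_nonneg \<phi>)
    then show "norm (f a) \<le> nrm (dual (dual (dual A))) \<phi> * nrm A a"
      using A''.dual_norm_bound[OF \<phi> canon_in_bidual, of a] by (simp add: f_def)
  qed simp
  moreover have "D a = dual_left A a f - dual_right A f a" for a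
  proof
    fix b
    have "D a b = second_transpose D (canon a) (canon b)"
      using transpose_in[OF canon_in_bidual] D_in
      by (simp add: second_transpose_def canon_in_bidual canon_def[of a])
        (simp add: transpose_def canon_def)
    also have "\<dots> = \<phi> (arens A (canon b) (canon a)) - \<phi> (arens A (canon a) (canon b))"
      by (simp add: inner canon_in_bidual dual_left_def dual_right_def)
    also have "\<dots> = (dual_left A a f - dual_right A f a) b"
      by (simp add: arens_canon_canon f_def dual_left_def dual_right_def)
    finally show "D a b = (dual_left A a f - dual_right A f a) b" .
  qed
  ultimately show ?thesis by (auto simp: inner_derivation_def)
qed

end

end

theorem mainTheorem8:
  fixes scl :: "'k::real_normed_field \<Rightarrow> 'a::{real_normed_algebra,banach} \<Rightarrow> 'a"
  assumes "banach_algebra_over scl"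
    and "bidual_I_wsw (algebra_of scl)"
    and "weakly_amenable (bidual_algebra (algebra_of scl))"
  shows "weakly_amenable (algebra_of scl)"
proof -
  interpret banach_algebra_over scl by fact
  show ?thesis
    using assms(2,3) second_transpose_derivation inner_if_second_transpose_inner
    unfolding weakly_amenable_def by blast
qed

end
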